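(* Let $F$ be a field of prime characteristic $p$. Suppose that $r,s\geq1$ are integers and $V_r\otimes V_s=\bigoplus_{i=1}^{t}m_iV_{\mu_i}$, where the summands are nonzero (so each $\mu_i>0$ and each $m_i>0$) and the $\mu_i$ are distinct. If a multiplicity satisfies $m_i>1$, then $\mu_i$ is divisible by $p$.
   Context: $F$ is a field of prime characteristic $p$. $J_r(1)$ denotes the $r\times r$ Jordan block over $F$ with eigenvalue $1$. For $r\le p^n$, $V_r$ is the indecomposable $r$-dimensional module over $F$ of the cyclic group $C_{p^n}$ on which a fixed generator acts as $J_r(1)$ (regarded as a module for every $C_{p^n}$ with $p^n\geq r$). $mV$ denotes the direct sum of $m$ copies of $V$. The module decomposition $V_r\otimes V_s=\bigoplus_{i=1}^t m_iV_{\mu_i}$ (up to isomorphism, for any $n$ with $\max(r,s)\leq p^n$) is equivalent to saying that the Jordan canonical form of $J_r(1)\otimes J_s(1)$ over $F$ has exactly $m_i$ blocks of size $\mu_i$ for each $i$, and no other blocks. *)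

theory Defs
  imports
    "HOL-Algebra.Elementary_Groups"
    "HOL-Computational_Algebra.Primes"
    "Jordan_Normal_Form.Jordan_Normal_Form"
begin

text \<open>A finite-dimensional module over the group algebra \<open>F G\<close>, with a chosen basis, is a matrix
  representation \<open>G \<Rightarrow> GL\<^sub>d(F)\<close>. Values outside \<open>carrier G\<close> are irrelevant.\<close>

definition is_mat_rep :: "('g, 'b) monoid_scheme \<Rightarrow> nat \<Rightarrow> ('g \<Rightarrow> 'a::field mat) \<Rightarrow> bool" where
  "is_mat_rep G d \<rho> \<longleftrightarrow>
     (\<forall>g\<in>carrier G. \<rho> g \<in> carrier_mat d d) \<and>
     \<rho> \<one>\<^bsub>G\<^esub> = 1\<^sub>m d \<and>
     (\<forall>g\<in>carrier G. \<forall>h\<in>carrier G. \<rho> (g \<otimes>\<^bsub>G\<^esub> h) = \<rho> g * \<rho> h)"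

text \<open>The base change \<open>P\<close> (with inverse \<open>Q\<close>) must be the same for all group elements.\<close>

definition rep_iso :: "('g, 'b) monoid_scheme \<Rightarrow> ('g \<Rightarrow> 'a::field mat) \<Rightarrow> ('g \<Rightarrow> 'a mat) \<Rightarrow> bool" where
  "rep_iso G \<rho> \<sigma> \<longleftrightarrow> (\<exists>P Q. \<forall>g\<in>carrier G. similar_mat_wit (\<rho> g) (\<sigma> g) P Q)"

definition kronecker_mat :: "'a::semiring_1 mat \<Rightarrow> 'a mat \<Rightarrow> 'a mat" where
  "kronecker_mat A B = mat (dim_row A * dim_row B) (dim_col A * dim_col B)
     (\<lambda>(i, j). A $$ (i div dim_row B, j div dim_col B) * B $$ (i mod dim_row B, j mod dim_col B))"

definition tensor_rep :: "('g \<Rightarrow> 'a::field mat) \<Rightarrow> ('g \<Rightarrow> 'a mat) \<Rightarrow> 'g \<Rightarrow> 'a mat" where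
  "tensor_rep \<rho> \<sigma> = (\<lambda>g. kronecker_mat (\<rho> g) (\<sigma> g))"

definition direct_sum_rep :: "('g \<Rightarrow> 'a::field mat) list \<Rightarrow> 'g \<Rightarrow> 'a mat" where
  "direct_sum_rep \<rho>s = (\<lambda>g. diag_block_mat (map (\<lambda>\<rho>. \<rho> g) \<rho>s))"

definition copies_rep :: "nat \<Rightarrow> ('g \<Rightarrow> 'a::field mat) \<Rightarrow> 'g \<Rightarrow> 'a mat" where
  "copies_rep m \<rho> = direct_sum_rep (replicate m \<rho>)"

text \<open>\<open>C\<^bsub>p^n\<^esub>\<close> is \<open>integer_mod_group (p ^ n)\<close>, with carrier \<open>{0..<p ^ n}\<close> and generator \<open>1\<close>
  (for \<open>n > 0\<close>). The generator acts on \<open>V\<^sub>r\<close> as \<open>J\<^sub>r(1)\<close>, hence \<open>k\<close> acts as \<open>J\<^sub>r(1)\<^sup>k\<close>. In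
  characteristic \<open>p\<close> this is a representation of \<open>C\<^bsub>p^n\<^esub>\<close> whenever \<open>r \<le> p ^ n\<close>; see
  \<open>is_mat_rep_V_rep\<close> below.\<close>

definition V_rep :: "nat \<Rightarrow> int \<Rightarrow> 'a::field mat" where
  "V_rep r = (\<lambda>k. jordan_block r 1 ^\<^sub>m nat k)"

lemma mat_pow_add:
  assumes "A \<in> carrier_mat d d"
  shows "A ^\<^sub>m (k + l) = A ^\<^sub>m k * A ^\<^sub>m l"
proof (induction l)
  case 0
  then show ?case using assms by simp
next
  case (Suc l)
  then show ?case using assms
    by (simp add: assoc_mult_mat[of _ d d _ d _ d])
qed

lemma prime_dvd_prime_power_choose:
  fixes p :: nat
  assumes "prime p" "0 < k" "k < p ^ n"
  shows "p dvd (p ^ n choose k)"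
proof (rule ccontr)
  assume "\<not> p dvd (p ^ n choose k)"
  then have "coprime (p ^ n) (p ^ n choose k)"
    using assms(1) by (simp add: prime_imp_coprime coprime_power_left_iff)
  moreover have "k * (p ^ n choose k) = p ^ n * (p ^ n - 1 choose (k - 1))"
    using assms(2) by (rule times_binomial_minus1_eq)
  then have "p ^ n dvd k * (p ^ n choose k)"
    by simp
  ultimately have "p ^ n dvd k"
    using coprime_dvd_mult_left_iff by blast
  then show False
    using assms(2,3) by (simp add: nat_dvd_not_less)
qed

lemma jordan_block_pow_prime_power:
  assumes "prime p" "CHAR('a::field) = p" "r \<le> p ^ n"
  shows "jordan_block r (1::'a) ^\<^sub>m (p ^ n) = 1\<^sub>m r"
proof (rule eq_matI)
  fix i j assume "i < dim_row (1\<^sub>m r :: 'a mat)" "j < dim_col (1\<^sub>m r :: 'a mat)"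
  then have ij: "i < r" "j < r" by auto
  have "of_nat (p ^ n choose (j - i)) = (0::'a)" if "i < j"
    using prime_dvd_prime_power_choose[of p "j - i" n] that ij assms
    by (simp add: of_nat_eq_0_iff_char_dvd)
  then show "(jordan_block r (1::'a) ^\<^sub>m (p ^ n)) $$ (i, j) = 1\<^sub>m r $$ (i, j)"
    using ij by (cases i j rule: linorder_cases) (simp_all add: jordan_block_pow)
qed auto

lemma is_mat_rep_V_rep:
  assumes "prime p" "CHAR('a::field) = p" "r \<le> p ^ n"
  shows "is_mat_rep (integer_mod_group (p ^ n)) r (V_rep r :: int \<Rightarrow> 'a mat)"
proof -
  let ?J = "jordan_block r (1::'a)"
  have J: "?J \<in> carrier_mat r r" by simp
  have N: "0 < p ^ n" using assms(1) by (simp add: prime_gt_0_nat)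
  have "?J ^\<^sub>m nat ((x + y) mod int (p ^ n)) = ?J ^\<^sub>m nat x * ?J ^\<^sub>m nat y"
    if xy: "0 \<le> x" "0 \<le> y" "x < int (p ^ n)" "y < int (p ^ n)" for x y
  proof (cases "x + y < int (p ^ n)")
    case True
    then show ?thesis using xy
      by (simp add: nat_add_distrib mat_pow_add[OF J])
  next
    case False
    have "(x + y) mod int (p ^ n) = (x + y - int (p ^ n)) mod int (p ^ n)"
      by (metis minus_mod_self2)
    also have "\<dots> = x + y - int (p ^ n)"
      using xy False by (intro mod_pos_pos_trivial) linarith+
    finally have m: "(x + y) mod int (p ^ n) = x + y - int (p ^ n)" .
    have "nat x + nat y = nat (x + y - int (p ^ n)) + p ^ n"
      using False xy by linarith
    then have "?J ^\<^sub>m nat x * ?J ^\<^sub>m nat y = ?J ^\<^sub>m nat (x + y - int (p ^ n)) * ?J ^\<^sub>m (p ^ n)"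
      by (metis mat_pow_add[OF J])
    also have "\<dots> = ?J ^\<^sub>m nat (x + y - int (p ^ n))"
      using jordan_block_pow_prime_power[OF assms] by simp
    finally show ?thesis by (simp only: m)
  qed
  then show ?thesis using N
    by (auto simp: is_mat_rep_def V_rep_def carrier_integer_mod_group)
qed

end

theory Submission
  imports
    Defs
    "Jordan_Normal_Form.DL_Rank"
    "Jordan_Normal_Form.Jordan_Normal_Form_Uniqueness"
begin

text \<open>
  Write \<open>T = J\<^sub>r(1) \<otimes> J\<^sub>s(1)\<close>, \<open>E = T - 1\<close>, \<open>X = J\<^sub>r(0) \<otimes> 1\<close> and
  \<open>D = 1 \<otimes> diag(0, \<dots>, s - 1)\<close>. Then \<open>E X = X E\<close> and \<open>D E - E D = X - E\<close>, so \<open>D\<close> acts on powers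
  of \<open>E\<close> like a derivation. (On \<open>F[x, y]/(x\<^sup>r, y\<^sup>s)\<close>, \<open>E\<close> and \<open>X\<close> are multiplication by
  \<open>(1 + x)(1 + y) - 1\<close> and \<open>x\<close>, and \<open>D\<close> is \<open>y \<partial>/\<partial>y\<close> up to sign and an additive constant.)
  Put \<open>S\<^sub>k = ker E \<inter> im E\<^sup>k\<close>; the number of Jordan blocks of \<open>T\<close> of size \<open>\<mu>\<close> is the dimension of
  \<open>S\<^bsub>\<mu> - 1\<^esub> / S\<^sub>\<mu>\<close>. If \<open>E\<^sup>\<mu> v = 0\<close>, applying \<open>D\<close> gives \<open>E\<^sup>\<mu> D v + \<mu> E\<^bsup>\<mu> - 1\<^esup> X v = 0\<close>. Hence \<open>X\<close>
  maps \<open>S\<^bsub>\<mu> - 1\<^esub>\<close> into \<open>S\<^sub>\<mu>\<close> as soon as \<open>p\<close> does not divide \<open>\<mu>\<close>. The common kernel of \<open>X\<close> and \<open>E\<close>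
  is a line, so in that case the quotient has dimension at most 1.
\<close>

section \<open>Subspaces of the coordinate space and their dimensions\<close>

context vec_space
begin

abbreviation subdim :: "'a vec set \<Rightarrow> nat" where
  "subdim U \<equiv> vectorspace.dim class_ring (vs U)"

lemma subspaceI:
  assumes "U \<subseteq> carrier_vec n" "0\<^sub>v n \<in> U"
    and "\<And>v w. v \<in> U \<Longrightarrow> w \<in> U \<Longrightarrow> v + w \<in> U"
    and "\<And>c v. v \<in> U \<Longrightarrow> c \<cdot>\<^sub>v v \<in> U"
  shows "subspace class_ring U V"
  unfolding subspace_def submodule_def
  using assms vec_vs module_axioms by (auto simp: module_vec_simps)

lemma subspaceD:
  assumes "subspace class_ring U V"
  shows "U \<subseteq> carrier_vec n" "0\<^sub>v n \<in> U"
    and "\<And>v w. v \<in> U \<Longrightarrow> w \<in> U \<Longrightarrow> v + w \<in> U"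
    and "\<And>c v. v \<in> U \<Longrightarrow> c \<cdot>\<^sub>v v \<in> U"
  using assms unfolding subspace_def submodule_def by (auto simp: module_vec_simps class_ring_simps)

lemma subspace_mat_kernel:
  assumes "A \<in> carrier_mat n n"
  shows "subspace class_ring (mat_kernel A) V"
  using assms by (intro subspaceI) (auto simp: mat_kernel mult_add_distrib_mat_vec mult_mat_vec)

lemma subspace_Int:
  assumes "subspace class_ring U V" "subspace class_ring W V"
  shows "subspace class_ring (U \<inter> W) V"
  using subspaceD[OF assms(1)] subspaceD[OF assms(2)] by (intro subspaceI) auto

lemma subspace_image:
  assumes A: "A \<in> carrier_mat n n" and U: "subspace class_ring U V"
  shows "subspace class_ring ((*\<^sub>v) A ` U) V"
proof (rule subspaceI)
  note U' = subspaceD[OF U]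
  show "(*\<^sub>v) A ` U \<subseteq> carrier_vec n" using A U'(1) by auto
  have "A *\<^sub>v 0\<^sub>v n = 0\<^sub>v n" using A by auto
  then show "0\<^sub>v n \<in> (*\<^sub>v) A ` U" using U'(2) by (metis image_eqI)
  fix v w assume "v \<in> (*\<^sub>v) A ` U" "w \<in> (*\<^sub>v) A ` U"
  then obtain v' w' where *: "v' \<in> U" "w' \<in> U" "v = A *\<^sub>v v'" "w = A *\<^sub>v w'" by auto
  then have "v + w = A *\<^sub>v (v' + w')"
    using mult_add_distrib_mat_vec[OF A] U'(1) by (metis subsetD)
  then show "v + w \<in> (*\<^sub>v) A ` U" using U'(3) * by blast
next
  note U' = subspaceD[OF U]
  fix c v assume "v \<in> (*\<^sub>v) A ` U"
  then obtain v' where *: "v' \<in> U" "v = A *\<^sub>v v'" by auto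
  then have "c \<cdot>\<^sub>v v = A *\<^sub>v (c \<cdot>\<^sub>v v')"
    using mult_mat_vec[OF A] U'(1) by (metis subsetD)
  then show "c \<cdot>\<^sub>v v \<in> (*\<^sub>v) A ` U" using U'(4) * by blast
qed

text \<open>Linear independence inside \<open>U\<close> agrees with independence in the whole space,
  so independent subsets of \<open>U\<close> have at most \<open>n\<close> elements. Starting from
  the empty set, a maximal one exists, and it generates \<open>U\<close>.\<close>

lemma fin_dim_subspace:
  assumes "subspace class_ring U V"
  shows "vectorspace.fin_dim class_ring (vs U)"
proof -
  interpret U: vectorspace class_ring "vs U" using subspace_is_vs[OF assms] .
  have U: "U \<subseteq> carrier_vec n" "submodule class_ring U V"
    using subspaceD(1)[OF assms] assms by (auto simp: subspace_def)
  have lin: "U.lin_dep S = lin_dep S" if "S \<subseteq> U" for S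
    using span_li_not_depend(2)[OF that U(2)] .
  have "\<exists>B. finite B \<and> maximal B (\<lambda>S. S \<subseteq> carrier (vs U) \<and> U.lin_indpt S)"
  proof (rule maximal_exists[where N = n and B = "{}"])
    fix S assume "S \<subseteq> carrier (vs U) \<and> U.lin_indpt S"
    then have "S \<subseteq> carrier_vec n" "lin_indpt S" using U lin by auto
    then show "finite S \<and> card S \<le> n"
      using li_le_dim[OF fin_dim] dim_is_n by auto
  qed (auto simp: U.lin_dep_def)
  then obtain B where "finite B" "maximal B (\<lambda>S. S \<subseteq> carrier (vs U) \<and> U.lin_indpt S)"
    by blast
  moreover from this have "U.gen_set B" by (intro U.max_li_is_gen)
  ultimately show ?thesis
    unfolding U.fin_dim_def by (auto simp: maximal_def)
qed

lemma subdim_mono: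
  assumes "subspace class_ring U V" "subspace class_ring W V" "U \<subseteq> W"
  shows "subdim U \<le> subdim W"
proof -
  interpret W: vectorspace class_ring "vs W" using subspace_is_vs[OF assms(2)] .
  have "subspace class_ring U (vs W)" using nested_subspaces[OF assms(2,1,3)] .
  from W.subspace_dim[OF this] fin_dim_subspace[OF assms(1)] fin_dim_subspace[OF assms(2)]
  show ?thesis by simp
qed

text \<open>Rank-nullity for the linear map that \<open>A\<close> induces from \<open>U\<close> into
  the whole space.\<close>

lemma subdim_image_kernel:
  assumes A: "A \<in> carrier_mat n n" and U: "subspace class_ring U V"
  shows "subdim ((*\<^sub>v) A ` U) + subdim (U \<inter> mat_kernel A) = subdim U"
proof -
  note U' = subspaceD[OF U]
  interpret U: vectorspace class_ring "vs U" using subspace_is_vs[OF U] .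
  have "linear_map class_ring (vs U) V ((*\<^sub>v) A)"
    unfolding linear_map_def mod_hom_def mod_hom_axioms_def module_hom_def
    using A U' U.vectorspace_axioms U.module_axioms vec_vs module_axioms
    by (auto simp: module_vec_simps mult_add_distrib_mat_vec mult_mat_vec subset_iff)
  then interpret T: linear_map class_ring "vs U" V "(*\<^sub>v) A" .
  have 1: "T.im = (*\<^sub>v) A ` U" unfolding T.im_def by simp
  have 2: "T.ker = U \<inter> mat_kernel A"
    unfolding T.ker_def using A U' by (auto simp: mat_kernel module_vec_simps)
  show ?thesis
    using T.rank_nullity fin_dim_subspace[OF U] unfolding 1 2 by simp
qed

lemma subdim_le_1:
  assumes U: "subspace class_ring U V" and u: "u \<in> carrier_vec n"
    and mult: "\<And>v. v \<in> U \<Longrightarrow> \<exists>c. v = c \<cdot>\<^sub>v u"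
  shows "subdim U \<le> 1"
proof -
  have sp: "subspace class_ring (span {u}) V" using span_is_subspace[of "{u}"] u by simp
  have us: "u \<in> span {u}" using u by (simp add: span_mem)
  have "U \<subseteq> span {u}"
    using mult subspaceD(4)[OF sp us] by (metis subsetI)
  then have "subdim U \<le> subdim (span {u})" using subdim_mono[OF U sp] by blast
  also have "\<dots> \<le> 1"
  proof (rule vectorspace.dim_le1I[OF subspace_is_vs[OF sp]])
    show "LinearCombinations.module.gen_set class_ring (vs (span {u})) {u}"
      using span_li_not_depend(1)[of "{u}" "span {u}"] us sp by (simp add: subspace_def)
  qed (use us in simp)
  finally show ?thesis .
qed

section \<open>Kernels of powers of a matrix and the derivation argument\<close>

lemma mat_kernel_pow_Suc:
  fixes E :: "'a mat"
  assumes E: "E \<in> carrier_mat n n"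
  shows "mat_kernel (E ^\<^sub>m k) \<subseteq> mat_kernel (E ^\<^sub>m Suc k)"
proof -
  have "E ^\<^sub>m Suc k = E * E ^\<^sub>m k"
    using mat_pow_add[OF E, of 1 k] E by simp
  then show ?thesis using mat_kernel_mult_subset[of "E ^\<^sub>m k" n n E n] E by simp
qed

text \<open>Rank-nullity for \<open>E ^\<^sub>m k\<close> restricted to the kernel of the next
  power. The image is the space S_k of the overview, so the successive differences of the kernel
  dimensions are the dimensions of the S_k.\<close>

lemma kernel_dim_pow_Suc:
  assumes E: "E \<in> carrier_mat n n"
  shows "kernel_dim (E ^\<^sub>m Suc k) =
    subdim ((*\<^sub>v) (E ^\<^sub>m k) ` mat_kernel (E ^\<^sub>m Suc k)) + kernel_dim (E ^\<^sub>m k)"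
proof -
  have "subdim (mat_kernel (E ^\<^sub>m j)) = kernel_dim (E ^\<^sub>m j)" for j
    using E by (simp add: kernel_dim_def)
  moreover have "mat_kernel (E ^\<^sub>m Suc k) \<inter> mat_kernel (E ^\<^sub>m k) = mat_kernel (E ^\<^sub>m k)"
    using mat_kernel_pow_Suc[OF E] by blast
  ultimately show ?thesis
    using subdim_image_kernel[of "E ^\<^sub>m k" "mat_kernel (E ^\<^sub>m Suc k)"] subspace_mat_kernel E
    by (metis pow_carrier_mat)
qed

lemma pow_commute_vec:
  fixes E X :: "'a mat"
  assumes E: "E \<in> carrier_mat n n" and X: "X \<in> carrier_mat n n" and EX: "E * X = X * E"
    and v: "v \<in> carrier_vec n"
  shows "E ^\<^sub>m k *\<^sub>v (X *\<^sub>v v) = X *\<^sub>v (E ^\<^sub>m k *\<^sub>v v)"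
proof -
  have "E ^\<^sub>m k * X = X * E ^\<^sub>m k"
  proof (induction k)
    case (Suc k)
    have "E ^\<^sub>m k * E * X = E ^\<^sub>m k * X * E"
      using E X EX by (simp add: assoc_mult_mat[of _ n n _ n _ n])
    then show ?case using E X Suc by (simp add: assoc_mult_mat[of _ n n _ n _ n])
  qed (use E X in simp)
  then show ?thesis using assoc_mult_mat_vec[of _ n n _ n v] E X v by (metis pow_carrier_mat)
qed

text \<open>Leibniz rule for the commutator with \<open>D\<close>: as \<open>X - E\<close> commutes
  with \<open>E\<close>, each of the \<open>Suc k\<close> factors \<open>E\<close> contributes the
  same term.\<close>

lemma derivation_pow_vec:
  fixes E X D :: "'a mat"
  assumes E: "E \<in> carrier_mat n n" and X: "X \<in> carrier_mat n n" and D: "D \<in> carrier_mat n n"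
    and EX: "E * X = X * E" and DE: "D * E = E * D + (X - E)" and v: "v \<in> carrier_vec n"
  shows "D *\<^sub>v (E ^\<^sub>m Suc k *\<^sub>v v) =
    E ^\<^sub>m Suc k *\<^sub>v (D *\<^sub>v v) + of_nat (Suc k) \<cdot>\<^sub>v (E ^\<^sub>m k *\<^sub>v (X *\<^sub>v v - E *\<^sub>v v))"
  using v
\<comment> \<open>The innermost factor \<open>E\<close> is split off and the induction hypothesis is
  used at \<open>E *\<^sub>v v\<close>, so \<open>v\<close> has to vary.\<close>
proof (induction k arbitrary: v)
  have DE_vec: "D *\<^sub>v (E *\<^sub>v y) = E *\<^sub>v (D *\<^sub>v y) + (X *\<^sub>v y - E *\<^sub>v y)"
    if y: "y \<in> carrier_vec n" for y
  proof -
    have "D *\<^sub>v (E *\<^sub>v y) = (E * D + (X - E)) *\<^sub>v y"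
      using E D y by (simp add: assoc_mult_mat_vec[symmetric] DE)
    also have "\<dots> = E *\<^sub>v (D *\<^sub>v y) + (X *\<^sub>v y - E *\<^sub>v y)"
      using E D X y
      by (simp add: add_mult_distrib_mat_vec[of _ n n] minus_mult_distrib_mat_vec[of _ n n]
          minus_carrier_mat)
    finally show ?thesis .
  qed
  {
    case 0
    show ?case using DE_vec[OF 0] E X D 0 by simp
  next
    case (Suc k)
    define w where "w = X *\<^sub>v v - E *\<^sub>v v"
    have car: "E *\<^sub>v v \<in> carrier_vec n" "D *\<^sub>v v \<in> carrier_vec n" "X *\<^sub>v v \<in> carrier_vec n"
      "w \<in> carrier_vec n"
      using E X D Suc.prems by (auto simp: w_def)
    have pow: "E ^\<^sub>m Suc j *\<^sub>v y = E ^\<^sub>m j *\<^sub>v (E *\<^sub>v y)" if "y \<in> carrier_vec n" for j y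
      using E that assoc_mult_mat_vec[of "E ^\<^sub>m j" n n E n y] by simp
    have DEv: "D *\<^sub>v (E *\<^sub>v v) = E *\<^sub>v (D *\<^sub>v v) + w"
      unfolding w_def by (rule DE_vec[OF Suc.prems])
    have "X *\<^sub>v (E *\<^sub>v v) = E *\<^sub>v (X *\<^sub>v v)"
      using pow_commute_vec[OF E X EX Suc.prems, of 1] E by simp
    then have Ew: "X *\<^sub>v (E *\<^sub>v v) - E *\<^sub>v (E *\<^sub>v v) = E *\<^sub>v w"
      using mult_minus_distrib_mat_vec[OF E car(3) car(1)] by (simp add: w_def)
    have F: "E ^\<^sub>m Suc k \<in> carrier_mat n n" using E by (rule pow_carrier_mat)
    have "D *\<^sub>v (E ^\<^sub>m Suc (Suc k) *\<^sub>v v) = D *\<^sub>v (E ^\<^sub>m Suc k *\<^sub>v (E *\<^sub>v v))"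
      unfolding pow[OF Suc.prems, of "Suc k"] ..
    also have "\<dots> = E ^\<^sub>m Suc k *\<^sub>v (E *\<^sub>v (D *\<^sub>v v) + w) + of_nat (Suc k) \<cdot>\<^sub>v (E ^\<^sub>m k *\<^sub>v (E *\<^sub>v w))"
      unfolding Suc.IH[OF car(1)] DEv Ew ..
    also have "\<dots> = E ^\<^sub>m Suc (Suc k) *\<^sub>v (D *\<^sub>v v) + E ^\<^sub>m Suc k *\<^sub>v w
        + of_nat (Suc k) \<cdot>\<^sub>v (E ^\<^sub>m Suc k *\<^sub>v w)"
      unfolding pow[OF car(2)] pow[OF car(4), symmetric]
      using mult_add_distrib_mat_vec[OF F _ car(4)] E car(2) by simp
    also have "\<dots> = E ^\<^sub>m Suc (Suc k) *\<^sub>v (D *\<^sub>v v) + of_nat (Suc (Suc k)) \<cdot>\<^sub>v (E ^\<^sub>m Suc k *\<^sub>v w)"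
      using E by (intro eq_vecI) (simp_all add: algebra_simps)
    finally show ?case unfolding w_def .
  }
qed

text \<open>By \<open>kernel_dim_pow_Suc\<close> the claim amounts to dim S_k \<le> dim S_(k+1) + 1.
  This is rank-nullity for \<open>X\<close> on S_k, whose image lies in S_(k+1) and whose kernel
  lies in the span of \<open>u\<close>. The additive form avoids truncated subtraction.\<close>

lemma kernel_dim_pow_concave_up_to_1:
  fixes E X D :: "'a mat"
  assumes E: "E \<in> carrier_mat n n" and X: "X \<in> carrier_mat n n" and D: "D \<in> carrier_mat n n"
    and EX: "E * X = X * E" and DE: "D * E = E * D + (X - E)"
    and u: "u \<in> carrier_vec n"
    and socle: "\<And>v. v \<in> carrier_vec n \<Longrightarrow> E *\<^sub>v v = 0\<^sub>v n \<Longrightarrow> X *\<^sub>v v = 0\<^sub>v n \<Longrightarrow> \<exists>c. v = c \<cdot>\<^sub>v u"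
    and k: "of_nat (Suc k) \<noteq> (0 :: 'a)"
  shows "2 * kernel_dim (E ^\<^sub>m Suc k) \<le> kernel_dim (E ^\<^sub>m k) + kernel_dim (E ^\<^sub>m Suc (Suc k)) + 1"
proof -
  \<comment> \<open>As an image of a kernel, \<open>S j\<close> fits
    \<open>kernel_dim_pow_Suc\<close>; \<open>S_iff\<close> below identifies it with the
    intersection of the kernel of \<open>E\<close> and the image of
    \<open>E ^\<^sub>m j\<close>.\<close>
  define S :: "nat \<Rightarrow> 'a vec set" where "S j = (*\<^sub>v) (E ^\<^sub>m j) ` mat_kernel (E ^\<^sub>m Suc j)" for j
  have sub: "subspace class_ring (S j) V" for j
    unfolding S_def using E by (intro subspace_image subspace_mat_kernel pow_carrier_mat)
  \<comment> \<open>A matrix power takes its new factor on the right, so \<open>E\<close> is brought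
    to the left by commuting it with its own power.\<close>
  have pow: "E ^\<^sub>m Suc j *\<^sub>v y = E *\<^sub>v (E ^\<^sub>m j *\<^sub>v y)" if "y \<in> carrier_vec n" for j y
    using E that pow_commute_vec[OF E E refl that, of j] assoc_mult_mat_vec[of "E ^\<^sub>m j" n n E n y] by simp
  have S_iff: "w \<in> S j \<longleftrightarrow> E *\<^sub>v w = 0\<^sub>v n \<and> (\<exists>v\<in>carrier_vec n. w = E ^\<^sub>m j *\<^sub>v v)" for w j
    using pow unfolding S_def mat_kernel[OF pow_carrier_mat[OF E]] by auto
  have "X *\<^sub>v w \<in> S (Suc k)" if w: "w \<in> S k" for w
  proof -
    obtain v where v: "v \<in> carrier_vec n" "w = E ^\<^sub>m k *\<^sub>v v" and Ew: "E *\<^sub>v w = 0\<^sub>v n"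
      using w unfolding S_iff by blast
    define c :: 'a where "c = of_nat (Suc k)"
    have c: "c \<noteq> 0" using k by (simp add: c_def)
    have wc: "w \<in> carrier_vec n" using subspaceD(1)[OF sub] w by blast
    have "E *\<^sub>v (X *\<^sub>v w) = X *\<^sub>v (E *\<^sub>v w)"
      using pow_commute_vec[OF E X EX wc, of 1] E by simp
    then have EXw: "E *\<^sub>v (X *\<^sub>v w) = 0\<^sub>v n" using Ew X by auto
    have E0: "E ^\<^sub>m Suc k *\<^sub>v v = 0\<^sub>v n" using pow[OF v(1)] v(2) Ew by simp
    have D0: "D *\<^sub>v 0\<^sub>v n = 0\<^sub>v n" using D by auto
    \<comment> \<open>In the Leibniz rule for
      \<open>E ^\<^sub>m Suc k *\<^sub>v v = 0\<^sub>v n\<close>, the \<open>E\<close> part of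
      \<open>X - E\<close> reproduces this zero vector, and only \<open>X *\<^sub>v w\<close>
      survives.\<close>
    have "E ^\<^sub>m k *\<^sub>v (X *\<^sub>v v - E *\<^sub>v v) = E ^\<^sub>m k *\<^sub>v (X *\<^sub>v v) - E ^\<^sub>m Suc k *\<^sub>v v"
      using E X v(1) mult_minus_distrib_mat_vec[of "E ^\<^sub>m k" n n]
        assoc_mult_mat_vec[of "E ^\<^sub>m k" n n E n v] by simp
    also have "\<dots> = X *\<^sub>v w"
      unfolding E0 pow_commute_vec[OF E X EX v(1)] v(2)[symmetric]
      by (rule minus_zero_vec[OF mult_mat_vec_carrier[OF X wc]])
    finally have "0\<^sub>v n = E ^\<^sub>m Suc k *\<^sub>v (D *\<^sub>v v) + c \<cdot>\<^sub>v (X *\<^sub>v w)"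
      using derivation_pow_vec[OF E X D EX DE v(1), of k] D0 unfolding E0 c_def by simp
    \<comment> \<open>The identity is solved for \<open>X *\<^sub>v w\<close> coordinatewise;
      dividing by \<open>c\<close> is where \<open>Suc k\<close> must be invertible in the
      field.\<close>
    then have "(E ^\<^sub>m Suc k *\<^sub>v (D *\<^sub>v v)) $ i + c * (X *\<^sub>v w) $ i = 0" if "i < n" for i
      using that E X wc by (metis index_add_vec(1) index_smult_vec index_zero_vec(1)
          carrier_matD(1) dim_mult_mat_vec)
    then have "X *\<^sub>v w = (- inverse c) \<cdot>\<^sub>v (E ^\<^sub>m Suc k *\<^sub>v (D *\<^sub>v v))"
      using E X c by (intro eq_vecI) (auto simp: field_simps add_eq_0_iff)
    also have "\<dots> = E ^\<^sub>m Suc k *\<^sub>v ((- inverse c) \<cdot>\<^sub>v (D *\<^sub>v v))"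
      using mult_mat_vec_carrier[OF D v(1)] by (rule mult_mat_vec[OF pow_carrier_mat[OF E], symmetric])
    finally show ?thesis
      unfolding S_iff using EXw D v(1) by (metis mult_mat_vec_carrier smult_carrier_vec)
  qed
  then have "subdim ((*\<^sub>v) X ` S k) \<le> subdim (S (Suc k))"
    by (intro subdim_mono subspace_image X sub) auto
  moreover have "subdim (S k \<inter> mat_kernel X) \<le> 1"
    using X S_iff subspaceD(1)[OF sub]
    by (intro subdim_le_1[OF subspace_Int[OF sub subspace_mat_kernel[OF X]] u] socle)
      (auto simp: mat_kernel)
  ultimately have "subdim (S k) \<le> subdim (S (Suc k)) + 1"
    using subdim_image_kernel[OF X sub] by (metis add_mono)
  then show ?thesis
    using kernel_dim_pow_Suc[OF E, of k] kernel_dim_pow_Suc[OF E, of "Suc k"] by (simp add: S_def)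
qed

end

section \<open>Kronecker products of matrices\<close>

text \<open>The range is cut into \<open>m\<close> blocks of length \<open>n\<close>, and the
  position inside the i-th block is k - i n. This matches the index convention of
  \<open>kronecker_mat\<close>.\<close>

lemma sum_div_mod:
  fixes f :: "nat \<Rightarrow> nat \<Rightarrow> 'a::comm_monoid_add"
  shows "(\<Sum>k<m * n. f (k div n) (k mod n)) = (\<Sum>i<m. \<Sum>j<n. f i j)"
proof -
  have "k div n = i" "k mod n = k - i * n" if "i * n \<le> k" "k < i * n + n" for i k
    using that div_nat_eqI[of n i k] by (auto simp: mult.commute modulo_nat_def)
  then have "(\<Sum>k\<in>{i * n..<i * n + n}. f (k div n) (k mod n)) = (\<Sum>j<n. f i j)"
    for i
    by (intro sum.reindex_bij_witness[of _ "\<lambda>j. i * n + j" "\<lambda>k. k - i * n"]) auto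
  then show ?thesis
    by (simp flip: sum.nat_group)
qed

lemma kronecker_mat_carrier [simp]:
  assumes "A \<in> carrier_mat a b" "B \<in> carrier_mat c d"
  shows "kronecker_mat A B \<in> carrier_mat (a * c) (b * d)"
  using assms by (simp add: kronecker_mat_def)

lemma kronecker_mat_index:
  assumes "A \<in> carrier_mat a b" "B \<in> carrier_mat c d" "i < a * c" "j < b * d"
  shows "kronecker_mat A B $$ (i, j) = A $$ (i div c, j div d) * B $$ (i mod c, j mod d)"
  using assms by (simp add: kronecker_mat_def)

lemma div_mod_less:
  fixes i :: nat
  assumes "i < a * c"
  shows "i div c < a" "i mod c < c"
  using assms by (auto simp: less_mult_imp_div_less) (metis mod_less_divisor mult_0_right not_gr_zero not_less_zero)

text \<open>The mixed-product rule. The summation index splits into a quotient and a remainder, and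
  commutativity of the scalars turns the double sum into a product of two sums.\<close>

lemma kronecker_mat_mult:
  fixes A :: "'a::comm_semiring_1 mat"
  assumes A: "A \<in> carrier_mat a b" and B: "B \<in> carrier_mat c d"
    and C: "C \<in> carrier_mat b e" and D: "D \<in> carrier_mat d f"
  shows "kronecker_mat A B * kronecker_mat C D = kronecker_mat (A * C) (B * D)"
proof (rule eq_matI)
  note [simp] = carrier_matD[OF A] carrier_matD[OF B] carrier_matD[OF C] carrier_matD[OF D]
  have AC: "A * C \<in> carrier_mat a e" and BD: "B * D \<in> carrier_mat c f"
    using A B C D by auto
  show "dim_row (kronecker_mat A B * kronecker_mat C D) = dim_row (kronecker_mat (A * C) (B * D))"
    "dim_col (kronecker_mat A B * kronecker_mat C D) = dim_col (kronecker_mat (A * C) (B * D))"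
    by (simp_all add: kronecker_mat_def)
  fix i j assume "i < dim_row (kronecker_mat (A * C) (B * D))" "j < dim_col (kronecker_mat (A * C) (B * D))"
  then have ij: "i < a * c" "j < e * f" by (simp_all add: kronecker_mat_def)
  note ij' = div_mod_less[OF ij(1)] div_mod_less[OF ij(2)]
  have "(kronecker_mat A B * kronecker_mat C D) $$ (i, j) =
    (\<Sum>k<b * d. kronecker_mat A B $$ (i, k) * kronecker_mat C D $$ (k, j))"
    using ij by (simp add: scalar_prod_def kronecker_mat_def atLeast0LessThan)
  also have "\<dots> = (\<Sum>k<b * d. (A $$ (i div c, k div d) * B $$ (i mod c, k mod d)) *
      (C $$ (k div d, j div f) * D $$ (k mod d, j mod f)))"
    using ij by (intro sum.cong) (simp_all add: kronecker_mat_index[OF A B] kronecker_mat_index[OF C D])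
  also have "\<dots> = (\<Sum>x<b. \<Sum>y<d. (A $$ (i div c, x) * B $$ (i mod c, y)) *
      (C $$ (x, j div f) * D $$ (y, j mod f)))"
    by (rule sum_div_mod)
  also have "\<dots> = (\<Sum>x<b. A $$ (i div c, x) * C $$ (x, j div f)) *
      (\<Sum>y<d. B $$ (i mod c, y) * D $$ (y, j mod f))"
    unfolding sum_product by (intro sum.cong) (simp_all add: ac_simps)
  also have "\<dots> = (A * C) $$ (i div c, j div f) * (B * D) $$ (i mod c, j mod f)"
    using ij' by (simp add: scalar_prod_def atLeast0LessThan)
  finally show "(kronecker_mat A B * kronecker_mat C D) $$ (i, j) = kronecker_mat (A * C) (B * D) $$ (i, j)"
    using kronecker_mat_index[OF AC BD ij] by simp
qed

lemma kronecker_mat_add_left: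
  assumes "A \<in> carrier_mat a b" "A' \<in> carrier_mat a b" "B \<in> carrier_mat c d"
  shows "kronecker_mat (A + A') B = kronecker_mat A B + kronecker_mat A' B"
  using assms by (intro eq_matI) (auto simp: kronecker_mat_def div_mod_less distrib_right)

lemma kronecker_mat_add_right:
  assumes "A \<in> carrier_mat a b" "B \<in> carrier_mat c d" "B' \<in> carrier_mat c d"
  shows "kronecker_mat A (B + B') = kronecker_mat A B + kronecker_mat A B'"
  using assms by (intro eq_matI) (auto simp: kronecker_mat_def div_mod_less distrib_left)

lemma kronecker_mat_one: "kronecker_mat (1\<^sub>m a) (1\<^sub>m b) = 1\<^sub>m (a * b)"
proof (rule eq_matI)
  fix i j assume "i < dim_row (1\<^sub>m (a * b) :: 'a mat)" "j < dim_col (1\<^sub>m (a * b) :: 'a mat)"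
  then have ij: "i < a * b" "j < a * b" by auto
  have "i = j \<longleftrightarrow> i div b = j div b \<and> i mod b = j mod b"
    by (metis div_mult_mod_eq)
  then show "(kronecker_mat (1\<^sub>m a) (1\<^sub>m b) :: 'a mat) $$ (i, j) = 1\<^sub>m (a * b) $$ (i, j)"
    using ij by (auto simp: kronecker_mat_index[of _ a a _ b b] div_mod_less)
qed (auto simp: kronecker_mat_def)

section \<open>The matrices \<open>E\<close>, \<open>X\<close> and \<open>D\<close> for the tensor
  product of two Jordan blocks\<close>

lemma jordan_block_1_eq: "jordan_block n (1 :: 'a::semiring_1) = jordan_block n 0 + 1\<^sub>m n"
  by (intro eq_matI) auto

context
  fixes r s :: nat and J J' N N' X D E :: "'a::field mat"
  defines "J \<equiv> jordan_block r 1" and "J' \<equiv> jordan_block s 1"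
    and "N \<equiv> jordan_block r 0" and "N' \<equiv> jordan_block s 0"
    and "X \<equiv> kronecker_mat N (1\<^sub>m s)" and "D \<equiv> kronecker_mat (1\<^sub>m r) (mat_diag s of_nat)"
    and "E \<equiv> char_matrix (kronecker_mat J J') 1"
begin

lemma X_carrier: "X \<in> carrier_mat (r * s) (r * s)"
  and D_carrier: "D \<in> carrier_mat (r * s) (r * s)"
  and E_carrier: "E \<in> carrier_mat (r * s) (r * s)"
  by (auto simp: X_def D_def E_def J_def J'_def N_def mat_diag_def)

text \<open>Matrix form of (1 + x)(1 + y) - 1 = (1 + x) y + x, with \<open>N\<close> and
  \<open>N'\<close> in the roles of x and y.\<close>

lemma E_eq: "E = kronecker_mat J N' + X"
proof -
  have T: "kronecker_mat J J' = kronecker_mat J N' + kronecker_mat J (1\<^sub>m s)"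
    unfolding J'_def jordan_block_1_eq[of s] N'_def[symmetric]
    by (rule kronecker_mat_add_right) (auto simp: J_def N'_def)
  have X: "kronecker_mat J (1\<^sub>m s) = X + 1\<^sub>m (r * s)"
    unfolding J_def jordan_block_1_eq[of r] X_def N_def kronecker_mat_one[symmetric]
    by (rule kronecker_mat_add_left) auto
  have "kronecker_mat J N' \<in> carrier_mat (r * s) (r * s)"
    by (simp add: J_def N'_def)
  then show ?thesis
    unfolding E_def char_matrix_def T X using X_carrier
    by (intro eq_matI) auto
qed

lemma X_commute_E: "E * X = X * E"
proof -
  have "J * N = N * J"
    unfolding J_def jordan_block_1_eq N_def[symmetric]
    by (subst add_mult_distrib_mat mult_add_distrib_mat, auto simp: N_def)+
  then have "kronecker_mat J N' * X = X * kronecker_mat J N'"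
    unfolding X_def by (subst (1 2) kronecker_mat_mult) (auto simp: J_def N_def N'_def)
  then show ?thesis
    unfolding E_eq using X_carrier
    by (subst add_mult_distrib_mat[of _ "r * s" "r * s"] mult_add_distrib_mat[of _ "r * s" "r * s"],
        auto simp: J_def N'_def)+
qed

text \<open>\<open>D\<close> commutes with \<open>X\<close>, which acts on the other tensor factor.
  The superdiagonal matrix \<open>N'\<close> lowers the diagonal weight by one, so the commutator of
  \<open>D\<close> with \<open>kronecker_mat J N'\<close> is the negative of that matrix, which is
  \<open>X - E\<close> by \<open>E_eq\<close>.\<close>

lemma D_commutator: "D * E = E * D + (X - E)"
proof -
  let ?G = "mat_diag s of_nat :: 'a mat"
  have KJN: "kronecker_mat J N' \<in> carrier_mat (r * s) (r * s)"
    by (simp add: J_def N'_def)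
  have NG: "N' * ?G = ?G * N' + N'"
    using mat_diag_mult_left[of N' s s "of_nat :: nat \<Rightarrow> 'a"]
      mat_diag_mult_right[of N' s s "of_nat :: nat \<Rightarrow> 'a"]
    by (auto simp: N'_def intro!: eq_matI)
  have "kronecker_mat J N' * D = kronecker_mat J (N' * ?G)"
    unfolding D_def by (subst kronecker_mat_mult[of _ r r _ s s _ r _ s]) (auto simp: J_def N'_def)
  also have "\<dots> = kronecker_mat J (?G * N') + kronecker_mat J N'"
    unfolding NG by (rule kronecker_mat_add_right[of _ r r _ s s])
      (auto simp: J_def N'_def intro!: mult_carrier_mat)
  also have "kronecker_mat J (?G * N') = D * kronecker_mat J N'"
    unfolding D_def by (subst kronecker_mat_mult[of _ r r _ s s _ r _ s]) (auto simp: J_def N'_def)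
  finally have KD: "kronecker_mat J N' * D = D * kronecker_mat J N' + kronecker_mat J N'" .
  have XD: "X * D = D * X"
    unfolding X_def D_def
    by (subst (1 2) kronecker_mat_mult[of _ r r _ s s _ r _ s])
      (auto simp: N_def left_mult_one_mat[OF mat_diag_dim] right_mult_one_mat[OF mat_diag_dim])
  have "E * D = D * kronecker_mat J N' + kronecker_mat J N' + D * X"
    unfolding E_eq add_mult_distrib_mat[OF KJN X_carrier D_carrier] KD XD ..
  moreover have "D * E = D * kronecker_mat J N' + D * X"
    unfolding E_eq mult_add_distrib_mat[OF D_carrier KJN X_carrier] ..
  ultimately show ?thesis
    unfolding E_eq using KJN X_carrier D_carrier by (intro eq_matI) auto
qed

text \<open>Coordinates are indexed by k = i s + j. The equation for \<open>X\<close> kills those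
  with i > 0; given this, the equation for \<open>E\<close> reduces to one for \<open>?Y\<close>,
  which kills those with i = 0 and j > 0.\<close>

lemma socle_kronecker:
  assumes v: "v \<in> carrier_vec (r * s)" and Ev: "E *\<^sub>v v = 0\<^sub>v (r * s)" and Xv: "X *\<^sub>v v = 0\<^sub>v (r * s)"
  shows "\<exists>c. v = c \<cdot>\<^sub>v unit_vec (r * s) 0"
proof -
  let ?Y = "kronecker_mat (1\<^sub>m r) N'"
  have Y: "?Y \<in> carrier_mat (r * s) (r * s)" by (simp add: N'_def)
  then have Y0: "?Y *\<^sub>v 0\<^sub>v (r * s) = 0\<^sub>v (r * s)" by auto
  \<comment> \<open>If row \<open>i\<close> of \<open>M\<close> is the k-th unit vector, then entry
    \<open>i\<close> of the product reads off coordinate \<open>k\<close> of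
    \<open>v\<close>.\<close>
  have single: "(M *\<^sub>v v) $ i = v $ k"
    if "M \<in> carrier_mat (r * s) (r * s)" "i < r * s" "k < r * s"
      "\<And>l. l < r * s \<Longrightarrow> M $$ (i, l) = (if l = k then 1 else 0)" for M i k
  proof -
    have "(M *\<^sub>v v) $ i = (\<Sum>l<r * s. M $$ (i, l) * v $ l)"
      using that(1,2) v by (simp add: scalar_prod_def atLeast0LessThan)
    also have "\<dots> = (\<Sum>l<r * s. if l = k then v $ l else 0)"
      using that(4) by (intro sum.cong) auto
    also have "\<dots> = v $ k" using that(3) by simp
    finally show ?thesis .
  qed
  have high: "v $ k = 0" if k: "k < r * s" "s \<le> k" for k
  proof -
    \<comment> \<open>Subtracting \<open>s\<close> lowers the first tensor index by one and keeps
      the second.\<close>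
    have "X $$ (k - s, l) = (if l = k then 1 else 0)" if "l < r * s" for l
    proof -
      have s: "s > 0" using that by (cases s) auto
      have eq: "l = k \<longleftrightarrow> l div s = k div s \<and> l mod s = k mod s"
        by (metis div_mult_mod_eq)
      have "k div s = Suc ((k - s) div s)" "k mod s = (k - s) mod s"
        using k s by (simp_all add: le_div_geq le_mod_geq)
      then show ?thesis
        unfolding X_def using that k eq s
        by (subst kronecker_mat_index[of _ r r _ s s]) (auto simp: N_def div_mod_less)
    qed
    then have "(X *\<^sub>v v) $ (k - s) = v $ k"
      using k X_carrier by (intro single) auto
    then show ?thesis using Xv k by simp
  qed
  \<comment> \<open>Since \<open>kronecker_mat J N'\<close> equals \<open>?Y + ?Y * X\<close>, the
    matrices \<open>E\<close> and \<open>?Y\<close> agree on vectors killed by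
    \<open>X\<close>.\<close>
  have "kronecker_mat J N' = kronecker_mat (1\<^sub>m r + N) N'"
    unfolding J_def N_def jordan_block_1_eq[of r] by (subst comm_add_mat[of _ r r]) auto
  also have "\<dots> = ?Y + kronecker_mat N N'"
    by (rule kronecker_mat_add_left[of _ r r _ _ s s]) (auto simp: N_def N'_def)
  also have "kronecker_mat N N' = kronecker_mat (1\<^sub>m r) N' * X"
    unfolding X_def by (subst kronecker_mat_mult[of _ r r _ s s _ r _ s]) (auto simp: N_def N'_def)
  finally have "E *\<^sub>v v = ?Y *\<^sub>v v + (?Y *\<^sub>v (X *\<^sub>v v) + X *\<^sub>v v)"
    unfolding E_eq using Y X_carrier v
    by (simp add: add_mult_distrib_mat_vec[of _ "r * s" "r * s"] assoc_mult_mat_vec[of _ "r * s" "r * s" _ "r * s"]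
        assoc_add_vec[of _ "r * s"])
  then have Yv: "?Y *\<^sub>v v = 0\<^sub>v (r * s)"
    unfolding Ev Xv Y0 using Y v by simp
  have low: "v $ k = 0" if k: "k < s" "0 < k" "k < r * s" for k
  proof -
    have "?Y $$ (k - 1, l) = (if l = k then 1 else 0)" if "l < r * s" for l
    proof -
      have eq: "l = k \<longleftrightarrow> l div s = k div s \<and> l mod s = k mod s"
        by (metis div_mult_mod_eq)
      moreover have "l div s < r" using that by (rule div_mod_less)
      then have "(1\<^sub>m r :: 'a mat) $$ (0, l div s) = (if l div s = 0 then 1 else 0)" by auto
      ultimately show ?thesis
        using that k
        by (subst kronecker_mat_index[of _ r r _ s s]) (auto simp: N'_def div_mod_less)
    qed
    then have "(?Y *\<^sub>v v) $ (k - 1) = v $ k"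
      using k Y by (intro single) auto
    then show ?thesis using Yv k by simp
  qed
  have "v = v $ 0 \<cdot>\<^sub>v unit_vec (r * s) 0"
  proof (rule eq_vecI)
    fix k assume "k < dim_vec (v $ 0 \<cdot>\<^sub>v unit_vec (r * s) 0)"
    then show "v $ k = (v $ 0 \<cdot>\<^sub>v unit_vec (r * s) 0) $ k"
      using high[of k] low[of k] by (cases "k = 0"; cases "k < s") (auto simp: unit_vec_def)
  qed (use v in auto)
  then show ?thesis ..
qed

end

section \<open>Counting Jordan blocks, and the passage from representations to Jordan forms\<close>

lemma jordan_nf_kronecker_mat_multiplicity:
  fixes n_as :: "(nat \<times> 'a::field) list"
  assumes nf: "jordan_nf (kronecker_mat (jordan_block r 1) (jordan_block s 1)) n_as"
    and k: "of_nat k \<noteq> (0 :: 'a)"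
  shows "length (filter ((=) (k, 1)) n_as) \<le> 1"
proof -
  define T :: "'a mat" where "T = kronecker_mat (jordan_block r 1) (jordan_block s 1)"
  \<comment> \<open>\<open>k\<close> is nonzero because its image in the field is. Blocks of size
    \<open>k\<close> are governed by the index k - 1, called \<open>j\<close>.\<close>
  obtain j where j: "k = Suc j" using k by (cases k) auto
  interpret vec_space "TYPE('a)" "r * s" .
  have "2 * kernel_dim (char_matrix T 1 ^\<^sub>m Suc j) \<le>
      kernel_dim (char_matrix T 1 ^\<^sub>m j) + kernel_dim (char_matrix T 1 ^\<^sub>m Suc (Suc j)) + 1"
    unfolding T_def
    by (rule kernel_dim_pow_concave_up_to_1[OF E_carrier X_carrier D_carrier X_commute_E D_commutator
          unit_vec_carrier socle_kronecker k[unfolded j]])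
  \<comment> \<open>The block count is 2 d_k - d_(k-1) - d_(k+1), where d_i is the kernel dimension
    of the i-th power of \<open>char_matrix T 1\<close>.\<close>
  then have "compute_nr_of_jordan_blocks T 1 k \<le> 1"
    unfolding compute_nr_of_jordan_blocks_def dim_gen_eigenspace_def j by simp
  then show ?thesis
    using compute_nr_of_jordan_blocks[OF nf] j unfolding T_def by simp
qed

lemma V_rep_dim [simp]:
  "dim_row (V_rep r k) = r" "dim_col (V_rep r k) = r"
  by (simp_all add: V_rep_def)

text \<open>Serves the case of the trivial group, where dimensions are compared.\<close>

lemma dim_row_direct_sum_copies:
  "dim_row (direct_sum_rep (map (\<lambda>i. copies_rep (m i) (V_rep (\<mu> i))) is) k) = (\<Sum>i\<leftarrow>is. m i * \<mu> i)"
  by (simp add: direct_sum_rep_def copies_rep_def dim_diag_block_mat o_def map_replicate sum_list_replicate)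

text \<open>The generator acts on each summand by a single Jordan block, so the direct sum is
  already in Jordan form.\<close>

lemma direct_sum_copies_generator:
  "direct_sum_rep (map (\<lambda>i. copies_rep (m i) (V_rep (\<mu> i))) is) 1 =
    jordan_matrix (concat (map (\<lambda>i. replicate (m i) (\<mu> i, 1 :: 'a::field)) is))"
proof -
  have "V_rep d 1 = (jordan_block d 1 :: 'a mat)" for d
    by (simp add: V_rep_def)
  then show ?thesis
    unfolding jordan_matrix_concat_diag_block_mat
    by (simp add: direct_sum_rep_def copies_rep_def jordan_matrix_def o_def map_replicate)
qed

theorem theorem4:
  fixes p n r s t :: nat and m \<mu> :: "nat \<Rightarrow> nat"
  assumes "prime p" and "CHAR('a::field) = p"
    and "r \<ge> 1" and "s \<ge> 1" and "r \<le> p ^ n" and "s \<le> p ^ n"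
    and "\<And>i. i < t \<Longrightarrow> m i > 0" and "\<And>i. i < t \<Longrightarrow> \<mu> i > 0"
    and "inj_on \<mu> {..<t}"
    and "rep_iso (integer_mod_group (p ^ n))
           (tensor_rep (V_rep r) (V_rep s) :: int \<Rightarrow> 'a mat)
           (direct_sum_rep (map (\<lambda>i. copies_rep (m i) (V_rep (\<mu> i))) [0..<t]))"
  shows "\<forall>i<t. m i > 1 \<longrightarrow> p dvd \<mu> i"
proof (intro allI impI)
  fix i assume i: "i < t" "m i > 1"
  let ?V = "tensor_rep (V_rep r) (V_rep s) :: int \<Rightarrow> 'a mat"
  let ?W = "direct_sum_rep (map (\<lambda>i. copies_rep (m i) (V_rep (\<mu> i))) [0..<t]) :: int \<Rightarrow> 'a mat"
  obtain P Q where wit: "similar_mat_wit (?V k) (?W k) P Q"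
    if "k \<in> carrier (integer_mod_group (p ^ n))" for k
    using assms(10) unfolding rep_iso_def by blast
  have carrier: "carrier (integer_mod_group (p ^ n)) = {0..<int (p ^ n)}"
    using assms(1) by (simp add: carrier_integer_mod_group prime_gt_0_nat)
  show "p dvd \<mu> i"
  proof (cases "n = 0")
    case True \<comment> \<open>Here \<open>1 \<notin> carrier\<close>, so only the dimensions of the two sides can be compared.\<close>
    have "0 \<in> carrier (integer_mod_group (p ^ n))" unfolding carrier True by simp
    from similar_mat_witD(4,5)[OF refl wit[OF this]] have "dim_row (?V 0) = dim_row (?W 0)"
      by (metis carrier_matD(1))
    moreover have "dim_row (?V 0) = 1"
      using assms(3-6) True by (simp add: tensor_rep_def kronecker_mat_def)
    ultimately have "(\<Sum>i\<leftarrow>[0..<t]. m i * \<mu> i) = 1"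
      unfolding dim_row_direct_sum_copies by simp
    moreover have "m i * \<mu> i \<le> (\<Sum>i\<leftarrow>[0..<t]. m i * \<mu> i)"
      using i by (intro member_le_sum_list) auto
    \<comment> \<open>At least two copies of a nonzero module cannot fit into dimension 1, so this
      case is contradictory.\<close>
    moreover have "1 < m i * \<mu> i"
      using i assms(8)[of i] by (cases "\<mu> i") auto
    ultimately show ?thesis by simp
  next
    case False
    then have "1 < p ^ n" using one_less_power[OF prime_gt_1_nat[OF assms(1)]] by blast
    then have "1 \<in> carrier (integer_mod_group (p ^ n))"
      unfolding carrier atLeastLessThan_iff by linarith
    from wit[OF this] have "similar_mat (?V 1) (?W 1)"
      unfolding similar_mat_def by blast
    moreover have "?V 1 = kronecker_mat (jordan_block r 1) (jordan_block s 1)"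
      by (simp add: tensor_rep_def V_rep_def)
    \<comment> \<open>A Jordan normal form must list no block of size 0; positivity of the
      \<open>\<mu> i\<close> ensures this.\<close>
    ultimately have "jordan_nf (kronecker_mat (jordan_block r 1) (jordan_block s 1) :: 'a mat)
        (concat (map (\<lambda>i. replicate (m i) (\<mu> i, 1)) [0..<t]))"
      unfolding jordan_nf_def direct_sum_copies_generator using assms(8) by force
    note mult = jordan_nf_kronecker_mat_multiplicity[OF this]
    have "m i = length (filter ((=) (\<mu> i, 1 :: 'a)) (replicate (m i) (\<mu> i, 1)))"
      by simp
    \<comment> \<open>The copies contributed by index \<open>i\<close> form one of the concatenated
      lists, so the total count of blocks of size \<open>\<mu> i\<close> is at least
      \<open>m i\<close>.\<close>
    also have "\<dots> \<le> length (filter ((=) (\<mu> i, 1 :: 'a))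
        (concat (map (\<lambda>i. replicate (m i) (\<mu> i, 1)) [0..<t])))"
      unfolding filter_concat length_concat using i
      by (intro member_le_sum_list) (auto simp: image_iff intro!: bexI[of _ i])
    \<comment> \<open>Contrapositive of \<open>mult\<close>: more than one block of size
      \<open>\<mu> i\<close> forces \<open>\<mu> i\<close> to vanish in the field.\<close>
    finally have "of_nat (\<mu> i) = (0 :: 'a)" using mult i by fastforce
    then show ?thesis using assms(2) by (simp add: of_nat_eq_0_iff_char_dvd)
  qed
qed

end
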